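(* Let $(\mathbb{S},\oplus,\odot,\mathbf{0},\mathbf{1})$ be a commutative semiring, let $d\ge1$, and let $z=(z_1,z_2,\dots)$ be an $\mathbb S^d$-valued time series that is eventually equal to $\mathbf 0^d$. Then $\mathrm{ISS}^{\mathbb S}_{0,\infty}(z)$ is invariant to inserting zeros into $z$: for all $k\ge1$ and all integers $1\le n_1\le\cdots\le n_k$, setting $z'=\tau_{n_1}\circ\cdots\circ\tau_{n_k}(z)$, one has $$\mathrm{ISS}^{\mathbb S}_{0,\infty}(z')=\mathrm{ISS}^{\mathbb S}_{0,\infty}(z),$$ where $\tau_n$ is the map inserting $\mathbf 0^d$ at position $n$.
   Context: A commutative semiring $(\mathbb S,\oplus,\odot,\mathbf 0,\mathbf 1)$ consists of two commutative monoids $(\mathbb S,\oplus,\mathbf 0)$ and $(\mathbb S,\odot,\mathbf 1)$ such that $\odot$ distributes over $\oplus$ and $\mathbf 0\odot s=\mathbf 0$ for all $s$. For $n\ge1$: $\tau_n(z)_m=z_m$ if $m<n$, $\tau_n(z)_n=\mathbf 0^d$, and $\tau_n(z)_m=z_{m-1}$ if $m>n$. The alphabet $A$ is the set of all non-constant formal commutative monomials $[a_1\cdots a_m]$ ($m\ge1$, $a_i\in\{1,\dots,d\}$), and $A^*$ is the set of words over $A$. For $z_j=(z_j^{(1)},\dots,z_j^{(d)})\in\mathbb S^d$ and $a=[a_1\cdots a_m]\in A$ put $z_j^{\odot a}:=z_j^{(a_1)}\odot\cdots\odot z_j^{(a_m)}$. The iterated-sums signature $\mathrm{ISS}^{\mathbb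 S}_{0,\infty}(z)$ is the map $A^*\to\mathbb S$ given, for $w=w_1\cdots w_k$ with $w_i\in A$, by $$\langle \mathrm{ISS}^{\mathbb S}_{0,\infty}(z),w\rangle:=\bigoplus_{0<j_1<\cdots<j_k<\infty} z_{j_1}^{\odot w_1}\odot\cdots\odot z_{j_k}^{\odot w_k},$$ with value $\mathbf 1$ on the empty word (only finitely many summands differ from $\mathbf 0$, and the sum is the sum of these). *)

theory Defs
  imports
    "HOL-Analysis.Finite_Cartesian_Product"
    "HOL-Library.Multiset"
    "HOL-Library.FuncSet"
begin

(* Commutative semirings are types of sort {comm_semiring_0, comm_monoid_mult}.  The class
   comm_semiring_1 would in addition require 0 \<noteq> 1 and so exclude the one-element semiring.

   A time series z_1, z_2, ... is a function on nat whose value at index 0 carries no meaning: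
   insert_zero never moves it when n \<ge> 1, and ISS never looks at it. *)

definition insert_zero :: "nat \<Rightarrow> (nat \<Rightarrow> 'a::zero ^ 'd) \<Rightarrow> nat \<Rightarrow> 'a ^ 'd" where
  "insert_zero n z m = (if m < n then z m else if m = n then 0 else z (m - 1))"

(* The formal commutative monomial [a_1 ... a_m] is the multiset {#a_1, ..., a_m#}. *)
definition alphabet :: "'d multiset set" where
  "alphabet = {a. a \<noteq> {#}}"

definition monomial_value :: "'a::comm_monoid_mult ^ 'd \<Rightarrow> 'd multiset \<Rightarrow> 'a" where
  "monomial_value v a = (\<Prod>i\<in>#a. v $ i)"

definition index_tuples :: "nat \<Rightarrow> nat list set" where
  "index_tuples k = {js. length js = k \<and> sorted_wrt (<) js \<and> (\<forall>j\<in>set js. 0 < j)}"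

definition iss_term ::
    "(nat \<Rightarrow> 'a::comm_monoid_mult ^ 'd) \<Rightarrow> 'd multiset list \<Rightarrow> nat list \<Rightarrow> 'a" where
  "iss_term z w js = (\<Prod>i<length w. monomial_value (z (js ! i)) (w ! i))"

(* The infinite sum is the finite sum of its nonzero summands; see finite_iss_support.
   Restricting to words over the alphabet makes ISS z a map with domain A^*, so that equality
   of signatures is equality on A^*. *)
definition ISS ::
    "(nat \<Rightarrow> 'a::{comm_semiring_0, comm_monoid_mult} ^ 'd) \<Rightarrow> 'd multiset list \<Rightarrow> 'a" where
  "ISS z = (\<lambda>w\<in>lists alphabet.
     \<Sum>js \<in> {js \<in> index_tuples (length w). iss_term z w js \<noteq> 0}. iss_term z w js)"

lemma ISS_Nil:
  fixes z :: "nat \<Rightarrow> 'a::{comm_semiring_0, comm_monoid_mult} ^ 'd"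
  shows "ISS z [] = 1"
proof (cases "(1::'a) = 0")
  case True
  then have "x = y" for x y :: 'a
    by (metis mult_1_left mult_zero_left)
  then show ?thesis .
next
  case False
  have "{js \<in> index_tuples (length []). iss_term z [] js \<noteq> 0} = {[]}"
    using False by (auto simp: index_tuples_def iss_term_def)
  then show ?thesis
    by (simp add: ISS_def iss_term_def)
qed

lemma finite_iss_support:
  fixes z :: "nat \<Rightarrow> 'a::{comm_semiring_0, comm_monoid_mult} ^ 'd"
  assumes ev: "eventually (\<lambda>m. z m = 0) sequentially" and w: "w \<in> lists alphabet"
  shows "finite {js \<in> index_tuples (length w). iss_term z w js \<noteq> 0}"
proof -
  obtain N where N: "\<And>m. N \<le> m \<Longrightarrow> z m = 0"
    using ev by (auto simp: eventually_sequentially)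
  have "set js \<subseteq> {..<N}"
    if js: "length js = length w" "iss_term z w js \<noteq> 0" for js
  proof (rule ccontr)
    assume "\<not> set js \<subseteq> {..<N}"
    then obtain i where i: "i < length w" "N \<le> js ! i"
      using js(1) by (force simp: in_set_conv_nth subset_eq not_less)
    from i(1) w have "w ! i \<noteq> {#}"
      by (auto simp: alphabet_def in_lists_conv_set)
    then obtain a b where "w ! i = add_mset a b"
      by (meson multiset_cases)
    then have "monomial_value (z (js ! i)) (w ! i) = 0"
      by (simp add: monomial_value_def N i)
    then have "iss_term z w js = 0"
      unfolding iss_term_def using i(1)
      by (subst prod.remove[of _ i]) auto
    with js(2) show False by contradiction
  qed
  then have "{js \<in> index_tuples (length w). iss_term z w js \<noteq> 0}
      \<subseteq> {js. set js \<subseteq> {..<N} \<and> length js = length w}"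
    by (auto simp: index_tuples_def)
  then show ?thesis
    by (rule finite_subset) (rule finite_lists_length_eq, simp)
qed

end

theory Submission
  imports Defs
begin

text \<open>Inserting a zero at position \<open>n\<close> relabels the time indices by the strictly increasing map
  that skips \<open>n\<close>. A tuple with a nonzero summand cannot meet \<open>n\<close>, because every letter is a
  nonconstant monomial, so the relabelling is a bijection between the nonzero summands of the two
  series.\<close>

definition skip :: "nat \<Rightarrow> nat \<Rightarrow> nat" where
  "skip n m = (if m < n then m else Suc m)"

text \<open>Left inverse of \<open>skip n\<close>. The point \<open>n\<close> lies outside the range
  of \<open>skip n\<close> and gets the default value \<open>n - 1\<close>; for
  \<open>n \<ge> 1\<close> this collides with the value at \<open>n - 1\<close>, so the laws below
  are stated away from \<open>n\<close>.\<close>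

definition unskip :: "nat \<Rightarrow> nat \<Rightarrow> nat" where
  "unskip n m = (if m < n then m else m - 1)"

lemma unskip_skip [simp]: "unskip n (skip n m) = m"
  by (simp add: skip_def unskip_def)

lemma skip_unskip: "m \<noteq> n \<Longrightarrow> skip n (unskip n m) = m"
  by (auto simp: skip_def unskip_def)

lemma unskip_less: "x < y \<Longrightarrow> x \<noteq> n \<Longrightarrow> y \<noteq> n \<Longrightarrow> unskip n x < unskip n y"
  unfolding unskip_def by arith

lemma insert_zero_skip [simp]: "insert_zero n z (skip n m) = z m"
  by (simp add: insert_zero_def skip_def)

lemma map_skip_index_tuples:
  "js \<in> index_tuples k \<Longrightarrow> map (skip n) js \<in> index_tuples k"
  by (auto simp: index_tuples_def skip_def sorted_wrt_map elim!: sorted_wrt_mono_rel[rotated])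

lemma map_unskip_index_tuples:
  assumes "js \<in> index_tuples k" and "n \<notin> set js" and "n \<ge> 1"
  shows "map (unskip n) js \<in> index_tuples k"
proof -
  have "sorted_wrt (<) js"
    using assms(1) by (simp add: index_tuples_def)
  then have "sorted_wrt (\<lambda>x y. unskip n x < unskip n y) js"
    using assms(2) by (elim sorted_wrt_mono_rel[rotated]) (metis unskip_less)
  moreover have "0 < unskip n j" if j: "j \<in> set js" for j
  proof -
    have "0 < j" "j \<noteq> n"
      using assms j by (auto simp: index_tuples_def)
    then show ?thesis
      \<comment> \<open>Since \<open>n \<ge> 1\<close>, \<open>unskip n\<close> fixes 0 and 0
        differs from \<open>n\<close>, so positivity is strict monotonicity applied to
        \<open>0 < j\<close>.\<close>
      using unskip_less[of 0 j n] assms(3) by simp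
  qed
  ultimately show ?thesis
    using assms(1) by (simp add: index_tuples_def sorted_wrt_map)
qed

lemma iss_term_map_skip:
  "length js = length w \<Longrightarrow> iss_term (insert_zero n z) w (map (skip n) js) = iss_term z w js"
  by (simp add: iss_term_def)

text \<open>The letter placed at time \<open>j\<close> is a nonempty monomial, so its value has a
  component of \<open>z j\<close> as a factor; this zero absorbs the whole product.\<close>

lemma iss_term_eq_0:
  fixes z :: "nat \<Rightarrow> 'a::{comm_semiring_0, comm_monoid_mult} ^ 'd"
  assumes "w \<in> lists alphabet" and "length js = length w" and "j \<in> set js" and "z j = 0"
  shows "iss_term z w js = 0"
proof -
  obtain i where i: "i < length w" "js ! i = j"
    using assms by (auto simp: in_set_conv_nth)
  then have "w ! i \<noteq> {#}"
    using assms(1) by (auto simp: alphabet_def in_lists_conv_set)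
  then obtain a b where "w ! i = add_mset a b"
    by (meson multiset_cases)
  then have "monomial_value (z (js ! i)) (w ! i) = 0"
    by (simp add: monomial_value_def i assms(4))
  then show ?thesis
    unfolding iss_term_def using i(1) by (subst prod.remove[of _ i]) auto
qed

lemma ISS_insert_zero:
  fixes z :: "nat \<Rightarrow> 'a::{comm_semiring_0, comm_monoid_mult} ^ 'd"
  assumes "n \<ge> 1"
  shows "ISS (insert_zero n z) = ISS z"
  unfolding ISS_def
proof (rule restrict_ext)
  fix w :: "'d multiset list"
  assume w: "w \<in> lists alphabet"
  let ?S = "\<lambda>z. {js \<in> index_tuples (length w). iss_term z w js \<noteq> 0}"
  have len: "length js = length w" if "js \<in> index_tuples (length w)" for js
    using that by (simp add: index_tuples_def)
  have avoid: "n \<notin> set js" if "js \<in> ?S (insert_zero n z)" for js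
    using that iss_term_eq_0[OF w, of js n "insert_zero n z"] len
    by (auto simp: insert_zero_def)
  have inv: "map (skip n) (map (unskip n) js) = js" if "js \<in> ?S (insert_zero n z)" for js
    using avoid[OF that] by (auto intro!: map_idI skip_unskip)
  \<comment> \<open>The summand identity for \<open>skip\<close> is applied to the unskipped tuple;
    \<open>inv\<close> then restores \<open>js\<close>.\<close>
  have val: "iss_term z w (map (unskip n) js) = iss_term (insert_zero n z) w js"
    if "js \<in> ?S (insert_zero n z)" for js
    using that iss_term_map_skip[of "map (unskip n) js" w n z] inv[OF that] len by simp
  show "(\<Sum>js\<in>?S (insert_zero n z). iss_term (insert_zero n z) w js)
      = (\<Sum>js\<in>?S z. iss_term z w js)"
  \<comment> \<open>Both maps preserve the summand, hence its being nonzero, so each carries one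
    index set into the other.\<close>
  proof (rule sum.reindex_bij_witness[where i = "map (skip n)" and j = "map (unskip n)"])
    fix js assume js: "js \<in> ?S (insert_zero n z)"
    show "map (skip n) (map (unskip n) js) = js"
      using inv[OF js] .
    show "map (unskip n) js \<in> ?S z"
      using js val[OF js] map_unskip_index_tuples[OF _ avoid[OF js] assms] by simp
    show "iss_term z w (map (unskip n) js) = iss_term (insert_zero n z) w js"
      using val[OF js] .
  next
    fix js assume js: "js \<in> ?S z"
    show "map (unskip n) (map (skip n) js) = js"
      by (simp add: map_idI)
    show "map (skip n) js \<in> ?S (insert_zero n z)"
      using js by (simp add: map_skip_index_tuples iss_term_map_skip len)
  qed
qed

theorem corollary3p13:
  fixes z :: "nat \<Rightarrow> 'a::{comm_semiring_0, comm_monoid_mult} ^ 'd::finite"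
    and ns :: "nat list"
  assumes "eventually (\<lambda>m. z m = 0) sequentially"
    and "ns \<noteq> []"
    and "sorted ns"
    and "\<forall>n\<in>set ns. 1 \<le> n"
  shows "ISS (foldr insert_zero ns z) = ISS z"
  \<comment> \<open>\<open>foldr\<close> applies the head of \<open>ns\<close> last, so each
    induction step removes the outermost insertion from the series built with the tail.\<close>
  using assms(4) by (induction ns) (simp_all add: ISS_insert_zero)

end
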